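(* For integers $1\leq k\leq n\leq 2k$, let $\hat{B}_{k,n}$ be the set of all $(x_1,\ldots,x_n)\in[0,1]^n$ with $x_{i+1}+\cdots+x_{i+k}\leq1$ for all $0\leq i\leq n-k$. Then \[ E^*(\hat{B}_{k,n},z)=Q_{n-k+1}(z), \] where $Q_m(z)=\sum_{j=1}^m N(m,j)z^{j-1}$ and $N(m,j)=\frac1m\binom mj\binom m{j-1}$ are the Narayana numbers.
   Context: For a lattice polytope $P\subset\mathbb{R}^n$, $E(P,t)=\#(tP\cap\mathbb{Z}^n)$ for integers $t\geq0$ and $E^*(P,z)=(1-z)^{n+1}\sum_{t\geq0}E(P,t)z^t$ is its Ehrhart $h^*$-polynomial. ($\hat{B}_{k,n}$ is a lattice polytope.) *)

theory Defs
  imports Complex_Main "HOL-Computational_Algebra.Computational_Algebra"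
begin

text \<open>
  Since the dimension \<open>n\<close> is a natural number parameter, a point \<open>(x\<^sub>1, \<dots>, x\<^sub>n)\<close> of
  \<open>n\<close>-space is represented by a function on \<open>nat\<close> that vanishes outside \<open>{1..n}\<close>.
\<close>

definition Rn :: "nat \<Rightarrow> (nat \<Rightarrow> real) set" where
  "Rn n = {x. \<forall>i. i \<notin> {1..n} \<longrightarrow> x i = 0}"

definition Zn :: "nat \<Rightarrow> (nat \<Rightarrow> real) set" where
  "Zn n = {x \<in> Rn n. \<forall>i\<in>{1..n}. x i \<in> \<int>}"

definition dilate :: "nat \<Rightarrow> (nat \<Rightarrow> real) set \<Rightarrow> (nat \<Rightarrow> real) set" where
  "dilate t P = (\<lambda>x i. real t * x i) ` P"

definition ehrhart :: "nat \<Rightarrow> (nat \<Rightarrow> real) set \<Rightarrow> nat \<Rightarrow> nat" where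
  "ehrhart n P t = card (dilate t P \<inter> Zn n)"

definition ehrhart_hstar :: "nat \<Rightarrow> (nat \<Rightarrow> real) set \<Rightarrow> rat fps" where
  "ehrhart_hstar n P = (1 - fps_X) ^ (n + 1) * Abs_fps (\<lambda>t. of_nat (ehrhart n P t))"

definition B_hat :: "nat \<Rightarrow> nat \<Rightarrow> (nat \<Rightarrow> real) set" where
  "B_hat k n = {x \<in> Rn n. (\<forall>i\<in>{1..n}. 0 \<le> x i \<and> x i \<le> 1) \<and>
                           (\<forall>i. i + k \<le> n \<longrightarrow> (\<Sum>j=i+1..i+k. x j) \<le> 1)}"

definition narayana :: "nat \<Rightarrow> nat \<Rightarrow> rat" where
  "narayana m j = 1 / of_nat m * of_nat (m choose j) * of_nat (m choose (j - 1))"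

definition narayana_poly :: "nat \<Rightarrow> rat poly" where
  "narayana_poly m = (\<Sum>j=1..m. monom (narayana m j) (j - 1))"

end

theory Submission
  imports Defs
begin

text \<open>
  Put \<open>r = n - k\<close> and \<open>q = k - r\<close>, and split a lattice point of the \<open>t\<close>-th dilate into blocks \<open>xs\<close>, \<open>ms\<close>,
  \<open>ys\<close> of lengths \<open>r\<close>, \<open>q\<close>, \<open>r\<close>. Every window contains all of \<open>ms\<close>, so that block contributes a
  factor \<open>(1 - z)\<^sup>-\<^sup>q\<close> to the Ehrhart series. What remains is to count pairs \<open>(xs, ys)\<close> such that a
  suffix of \<open>xs\<close> and the complementary prefix of \<open>ys\<close> always sum to at most \<open>s\<close>. The suffix sums of
  \<open>xs\<close> and \<open>s\<close> minus the prefix sums of \<open>ys\<close> form two non-crossing decreasing sequences, which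
  gives the Lindstroem-Gessel-Viennot determinant
  \[ {s + r \choose r}^2 - {s + r + 1 \choose r + 2} {s + r - 1 \choose r - 2}. \]
  Nanjundiah's identity expands both products in the polynomials \<open>s + 2 r - j\<close> choose \<open>2 r\<close>, where the
  coefficients are \<open>C(r, j)\<^sup>2\<close> and \<open>C(r, j - 1) C(r, j + 1)\<close>. Their difference is the Narayana
  number \<open>N(r + 1, j + 1)\<close>.
\<close>

section \<open>Power series and binomial identities\<close>

text \<open>Multiplying by \<open>1 - fps_X\<close> takes differences of consecutive coefficients,
  so Pascal's rule lowers \<open>q\<close> by one. The lower index \<open>M\<close> instead of
  \<open>q - 1\<close> keeps \<open>q = 0\<close> correct: the coefficient is 1 at
  \<open>M = 0\<close> and 0 afterwards, despite truncated subtraction.\<close>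

lemma one_minus_X_power_mult_choose:
  "(1 - fps_X) ^ q * Abs_fps (\<lambda>M. of_nat ((M + q - 1) choose M)) = (1 :: rat fps)"
proof (induction q)
  case 0
  show ?case
    by (rule fps_ext) (auto simp: binomial_eq_0)
next
  case (Suc q)
  have "(1 - fps_X) * Abs_fps (\<lambda>M. of_nat ((M + Suc q - 1) choose M)) =
        (Abs_fps (\<lambda>M. of_nat ((M + q - 1) choose M)) :: rat fps)"
  proof (rule fps_ext)
    fix M
    show "fps_nth ((1 - fps_X) * Abs_fps (\<lambda>M. of_nat ((M + Suc q - 1) choose M))) M =
          fps_nth (Abs_fps (\<lambda>M. of_nat ((M + q - 1) choose M)) :: rat fps) M"
      by (cases M) (simp_all add: algebra_simps)
  qed
  with Suc.IH show ?case
    by (simp only: power_Suc2 mult.assoc)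
qed

text \<open>Vandermonde expands \<open>x + k\<close> choose \<open>m + n\<close> in powers-like
  terms \<open>k choose i\<close>. After swapping the sums, \<open>inner\<close> evaluates the sum
  over \<open>k\<close> by trinomial revision and Vandermonde. A second trinomial revision extracts
  \<open>x choose m\<close>, and a last Vandermonde sums over \<open>i\<close>.\<close>

lemma nanjundiah:
  fixes a b m n x :: nat
  assumes "a + b = m + n"
  shows "(\<Sum>k\<le>n. (a choose k) * (b choose (n - k)) * ((x + k) choose (m + n))) =
         (x choose m) * ((x - m + a) choose n)"
proof -
  have inner: "(\<Sum>k\<le>n. (a choose k) * (k choose i) * (b choose (n - k))) =
                 (a choose i) * ((m + n - i) choose m)" if "i \<le> n" for i
  proof (cases "i \<le> a")
    case True
    have "(\<Sum>k\<le>n. (a choose k) * (k choose i) * (b choose (n - k))) =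
          (\<Sum>k=i..n. (a choose k) * (k choose i) * (b choose (n - k)))"
      by (rule sum.mono_neutral_right) (auto simp: binomial_eq_0)
    also have "\<dots> = (\<Sum>k=i..n. (a choose i) * (((a - i) choose (k - i)) * (b choose (n - k))))"
    proof (rule sum.cong)
      fix k assume "k \<in> {i..n}"
      then have "(a choose k) * (k choose i) = (a choose i) * ((a - i) choose (k - i))"
        using True by (cases "k \<le> a") (auto simp: choose_mult binomial_eq_0)
      then show "(a choose k) * (k choose i) * (b choose (n - k)) =
                 (a choose i) * (((a - i) choose (k - i)) * (b choose (n - k)))"
        by (simp add: mult.assoc)
    qed simp
    also have "\<dots> = (a choose i) * (\<Sum>k\<le>n - i. ((a - i) choose k) * (b choose (n - i - k)))"
      unfolding sum_distrib_left[symmetric]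
      by (rule arg_cong[where f = "(*) _"],
          rule sum.reindex_bij_witness[where i = "\<lambda>k. k + i" and j = "\<lambda>k. k - i"])
         (use that in auto)
    also have "\<dots> = (a choose i) * ((m + n - i) choose (n - i))"
      using vandermonde[of "a - i" b "n - i"] assms True by simp
    also have "(m + n - i) choose (n - i) = (m + n - i) choose m"
      using that by (subst binomial_symmetric) auto
    finally show ?thesis .
  qed (auto simp: binomial_eq_0)
  have "(\<Sum>k\<le>n. (a choose k) * (b choose (n - k)) * ((x + k) choose (m + n))) =
        (\<Sum>k\<le>n. \<Sum>i\<le>n. (x choose (m + n - i)) * ((a choose k) * (k choose i) * (b choose (n - k))))"
  proof (rule sum.cong)
    fix k assume k: "k \<in> {..n}"
    have "(x + k) choose (m + n) = (\<Sum>i\<le>m + n. (k choose i) * (x choose (m + n - i)))"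
      by (simp add: vandermonde add.commute)
    also have "\<dots> = (\<Sum>i\<le>n. (k choose i) * (x choose (m + n - i)))"
      using k by (intro sum.mono_neutral_right) (auto simp: binomial_eq_0)
    finally show "(a choose k) * (b choose (n - k)) * ((x + k) choose (m + n)) =
        (\<Sum>i\<le>n. (x choose (m + n - i)) * ((a choose k) * (k choose i) * (b choose (n - k))))"
      by (simp add: sum_distrib_left mult_ac)
  qed simp
  also have "\<dots> = (\<Sum>i\<le>n. (x choose (m + n - i)) *
                     (\<Sum>k\<le>n. (a choose k) * (k choose i) * (b choose (n - k))))"
    by (subst sum.swap) (simp add: sum_distrib_left)
  also have "\<dots> = (\<Sum>i\<le>n. (x choose m) * ((a choose i) * ((x - m) choose (n - i))))"
  proof (rule sum.cong)
    fix i assume "i \<in> {..n}"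
    then have i: "i \<le> n" by simp
    \<comment> \<open>For \<open>x < m\<close> the subtraction \<open>x - m\<close> is truncated,
      but the factor \<open>x choose m\<close> is then 0.\<close>
    have "(x choose (m + n - i)) * ((m + n - i) choose m) = (x choose m) * ((x - m) choose (n - i))"
    proof (cases "m + n - i \<le> x")
      case True
      then show ?thesis
        using choose_mult[of m "m + n - i" x] i by simp
    next
      case False
      then show ?thesis
        using i by (cases "m \<le> x") (auto simp: binomial_eq_0)
    qed
    then show "(x choose (m + n - i)) * (\<Sum>k\<le>n. (a choose k) * (k choose i) * (b choose (n - k))) =
               (x choose m) * ((a choose i) * ((x - m) choose (n - i)))"
      by (simp add: inner[OF i])
  qed simp
  also have "\<dots> = (x choose m) * ((x - m + a) choose n)"
    by (simp add: sum_distrib_left[symmetric] vandermonde add.commute)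
  finally show ?thesis .
qed

text \<open>Both neighbours of \<open>r choose j\<close> in its row are rational multiples of it,
  which reduces the claim to a rational identity. The index \<open>Suc r - j\<close> replaces its
  mirror image \<open>j - 1\<close> so that the term vanishes at \<open>j = 0\<close>.\<close>

lemma narayana_Suc_Suc:
  assumes "j \<le> r"
  shows "narayana (Suc r) (Suc j) =
    of_nat ((r choose j) * (r choose j)) - of_nat ((r choose Suc j) * (r choose (Suc r - j)))"
proof -
  define A where "A = (of_nat (r choose j) :: rat)"
  define B where "B = (of_nat (r choose Suc j) :: rat)"
  define Z where "Z = (of_nat (r choose (Suc r - j)) :: rat)"
  define d where "d = (of_nat (r - j) :: rat)"
  define p where "p = (of_nat j :: rat)"
  have r: "(of_nat r :: rat) = d + p"
    using assms by (simp add: d_def p_def flip: of_nat_add)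
  have "Suc j * (r choose Suc j) = (r - j) * (r choose j)"
    by (metis binomial_absorption binomial_absorb_comp)
  then have "of_nat (Suc j * (r choose Suc j)) = (of_nat ((r - j) * (r choose j)) :: rat)"
    by simp
  then have B: "(p + 1) * B = d * A"
    by (simp only: A_def B_def p_def d_def of_nat_mult of_nat_Suc add.commute)
  have "Suc (r - j) * (r choose Suc (r - j)) = (r - (r - j)) * (r choose (r - j))"
    by (metis binomial_absorption binomial_absorb_comp)
  then have "Suc (r - j) * (r choose (Suc r - j)) = j * (r choose j)"
    using assms by (simp add: Suc_diff_le binomial_symmetric[of j r])
  then have "of_nat (Suc (r - j) * (r choose (Suc r - j))) = (of_nat (j * (r choose j)) :: rat)"
    by simp
  then have Z: "(d + 1) * Z = p * A"
    by (simp only: A_def Z_def p_def d_def of_nat_mult of_nat_Suc add.commute)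
  have AZ: "(of_nat (Suc r choose j) :: rat) = A + Z"
  proof -
    have "Suc r choose j = Suc r choose (Suc r - j)"
      using assms by (intro binomial_symmetric) simp
    also have "\<dots> = (r choose (r - j)) + (r choose (Suc r - j))"
      using assms by (simp add: Suc_diff_le)
    finally show ?thesis
      using assms by (simp add: A_def Z_def binomial_symmetric[of j r])
  qed
  have AB: "(of_nat (Suc r choose Suc j) :: rat) = A + B"
    by (simp add: A_def B_def)
  have pos: "p + 1 > 0" "d + 1 > 0"
    by (simp_all add: p_def d_def add_nonneg_pos)
  have B': "B = d * A / (p + 1)" and Z': "Z = p * A / (d + 1)"
    using B Z pos by (simp_all add: field_simps)
  \<comment> \<open>Both sides equal \<open>A^2 (d + p + 1)^2 / ((p + 1) (d + 1))\<close>, because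
    \<open>(p + 1) (d + 1) - p d = d + p + 1\<close>.\<close>
  have "(A + B) * (A + Z) = (d + p + 1) * (A * A - B * Z)"
    unfolding B' Z' using pos by (simp add: divide_simps) (simp add: algebra_simps)
  moreover have "d + p + 1 > 0"
    using pos by (simp add: p_def d_def)
  moreover have "narayana (Suc r) (Suc j) = (A + B) * (A + Z) / (d + p + 1)"
    unfolding narayana_def diff_Suc_1 AZ AB by (simp add: r algebra_simps)
  ultimately show ?thesis
    by (simp add: A_def B_def Z_def)
qed

section \<open>Counting pairs of outer blocks\<close>

text \<open>The window starting at offset \<open>i\<close> meets the outer blocks in
  \<open>drop i xs\<close> and \<open>take i ys\<close>; \<open>c\<close> is what the middle block
  leaves of the bound.\<close>

definition window_bounded :: "nat \<Rightarrow> nat list \<Rightarrow> nat list \<Rightarrow> bool" where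
  "window_bounded c xs ys \<longleftrightarrow>
     (\<forall>i\<le>length xs. sum_list (drop i xs) + sum_list (take i ys) \<le> c)"

lemma window_bounded_Nil [simp]: "window_bounded c [] []"
  by (simp add: window_bounded_def)

text \<open>The window at \<open>i = 0\<close> gives the first condition. All later windows contain
  \<open>y\<close>, which is charged to the bound; \<open>y \<le> c\<close> guards the truncated
  subtraction.\<close>

lemma window_bounded_Cons:
  "window_bounded c (x # xs) (y # ys) \<longleftrightarrow>
     x + sum_list xs \<le> c \<and> y \<le> c \<and> window_bounded (c - y) xs ys"
proof -
  have "window_bounded c (x # xs) (y # ys) \<longleftrightarrow>
          x + sum_list xs \<le> c \<and>
          (\<forall>i\<le>length xs. sum_list (drop i xs) + (y + sum_list (take i ys)) \<le> c)"
    unfolding window_bounded_def length_Cons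
    by (simp only: less_Suc_eq_le[symmetric] All_less_Suc2) simp
  also have "(\<forall>i\<le>length xs. sum_list (drop i xs) + (y + sum_list (take i ys)) \<le> c) \<longleftrightarrow>
               y \<le> c \<and> window_bounded (c - y) xs ys"
  proof (cases "y \<le> c")
    case True
    then show ?thesis
      by (simp add: window_bounded_def le_diff_conv2 add_ac)
  next
    case False
    then show ?thesis
      by (auto intro!: exI[of _ 0])
  qed
  finally show ?thesis .
qed

text \<open>Fixing the sum of \<open>xs\<close> makes \<open>(a, c)\<close> the state of a
  recursion: \<open>a\<close> is the current suffix sum of \<open>xs\<close>, and \<open>c\<close>
  is what the prefix of \<open>ys\<close> read so far leaves of the bound.\<close>

definition bounded_pairs :: "nat \<Rightarrow> nat \<Rightarrow> nat \<Rightarrow> (nat list \<times> nat list) set" where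
  "bounded_pairs j a c =
     {(xs, ys). length xs = j \<and> length ys = j \<and> sum_list xs = a \<and> window_bounded c xs ys}"

lemma bounded_pairs_0: "bounded_pairs 0 a c = (if a = 0 then {([], [])} else {})"
  by (auto simp: bounded_pairs_def)

lemma bounded_pairs_empty: "c < a \<Longrightarrow> bounded_pairs j a c = {}"
  by (auto simp: bounded_pairs_def window_bounded_def)

text \<open>Removing both heads moves the state to \<open>(a', c')\<close>. The condition at
  \<open>i = 0\<close> is just \<open>a \<le> c\<close>, so both coordinates decrease independently;
  a crossing \<open>a' > c'\<close> only contributes an empty set.\<close>

lemma bounded_pairs_Suc:
  assumes "a \<le> c"
  shows "bounded_pairs (Suc j) a c =
    (\<lambda>((a', c'), (xs, ys)). ((a - a') # xs, (c - c') # ys)) `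
      (SIGMA (a', c') : {..a} \<times> {..c}. bounded_pairs j a' c')" (is "?L = ?f ` ?R")
proof
  show "?f ` ?R \<subseteq> ?L"
    using assms by (auto simp: bounded_pairs_def window_bounded_Cons)
  show "?L \<subseteq> ?f ` ?R"
  proof
    fix p assume p: "p \<in> ?L"
    then obtain x xs y ys where eq: "p = (x # xs, y # ys)"
      by (auto simp: bounded_pairs_def length_Suc_conv)
    have "p = ?f ((a - x, c - y), (xs, ys))" "((a - x, c - y), (xs, ys)) \<in> ?R"
      using p unfolding eq by (auto simp: bounded_pairs_def window_bounded_Cons)
    then show "p \<in> ?f ` ?R" by blast
  qed
qed

lemma finite_bounded_pairs: "finite (bounded_pairs j a c)"
proof (induction j arbitrary: a c)
  case (Suc j)
  then show ?case
    by (cases "a \<le> c") (auto simp: bounded_pairs_Suc bounded_pairs_empty intro!: finite_SigmaI)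
qed (simp add: bounded_pairs_0)

lemma card_bounded_pairs_Suc:
  assumes "a \<le> c"
  shows "card (bounded_pairs (Suc j) a c) = (\<Sum>a'\<le>a. \<Sum>c'\<le>c. card (bounded_pairs j a' c'))"
proof -
  have "inj_on (\<lambda>((a', c'), (xs, ys)). ((a - a') # xs, (c - c') # ys))
     (SIGMA (a', c') : {..a} \<times> {..c}. bounded_pairs j a' c')"
    by (auto simp: inj_on_def)
  then have "card (bounded_pairs (Suc j) a c) =
     card (SIGMA (a', c') : {..a} \<times> {..c}. bounded_pairs j a' c')"
    unfolding bounded_pairs_Suc[OF assms] by (rule card_image)
  also have "\<dots> = (\<Sum>(a', c')\<in>{..a} \<times> {..c}. card (bounded_pairs j a' c'))"
    by (subst card_SigmaI) (auto simp: finite_bounded_pairs case_prod_beta)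
  finally show ?thesis
    by (simp add: sum.cartesian_product)
qed

text \<open>Hockey-stick summation; \<open>u \<le> v\<close> makes the boundary term
  \<open>u\<close> choose \<open>v + 1\<close> vanish.\<close>

lemma sum_choose_upper:
  assumes "u \<le> v"
  shows "(\<Sum>a\<le>s. (a + u) choose v) = (s + u + 1) choose (v + 1)"
proof (induction s)
  case 0
  show ?case using assms by (cases "u = v") simp_all
qed simp

text \<open>Sums the determinant over its first coordinate; \<open>x\<close> and \<open>y\<close>
  stand for the factors free of \<open>a\<close>.\<close>

lemma sum_choose_det:
  "(\<Sum>a\<le>s. int ((a + i) choose i) * x - int ((a + i + 1) choose (i + 2)) * y) =
     int ((s + i + 1) choose (i + 1)) * x - int ((s + i + 2) choose (i + 3)) * y"
proof -
  have "(\<Sum>a\<le>s. (a + i) choose i) = (s + i + 1) choose (i + 1)"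
    by (rule sum_choose_upper) simp
  moreover have "(\<Sum>a\<le>s. (a + i + 1) choose (i + 2)) = (s + i + 2) choose (i + 3)"
    using sum_choose_upper[of "i + 1" "i + 2" s]
    by (simp add: numeral_eq_Suc del: binomial_Suc_Suc)
  ultimately show ?thesis
    by (simp only: sum_subtractf flip: sum_distrib_right of_nat_sum)
qed

text \<open>States with \<open>c' < a\<close> have no pairs, although \<open>closed\<close> speaks
  only of \<open>a \<le> c'\<close>. The sum still has a determinant form because that determinant
  vanishes at \<open>c = a - 1\<close>, where its two products coincide. Hence the assumption
  \<open>a \<le> c + 1\<close>, whose extreme case starts the induction for positive
  \<open>a\<close>.\<close>

lemma sum_card_bounded_pairs_snd:
  assumes closed: "\<And>c. a \<le> c \<Longrightarrow> int (card (bounded_pairs (Suc i) a c)) =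
     int ((a + i) choose i) * int ((c + i + 1) choose (i + 1)) -
     int ((a + i + 1) choose (i + 2)) * int ((c + i) choose (c + 1))"
  assumes "a \<le> c + 1"
  shows "(\<Sum>c'\<le>c. int (card (bounded_pairs (Suc i) a c'))) =
     int ((a + i) choose i) * int ((c + i + 2) choose (i + 2)) -
     int ((a + i + 1) choose (i + 2)) * int ((c + i + 1) choose (c + 1))"
  using assms(2)
proof (induction c)
  case 0
  show ?case
  proof (cases "a = 0")
    case True
    then show ?thesis using closed[of 0] by (simp add: binomial_eq_0)
  next
    case False
    then have "a = 1" using 0 by simp
    then show ?thesis by (simp add: bounded_pairs_empty)
  qed
next
  case (Suc c)
  show ?case
  proof (cases "a \<le> Suc c")
    case True
    have "(\<Sum>c'\<le>Suc c. int (card (bounded_pairs (Suc i) a c'))) =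
      int ((a + i) choose i) * (int ((c + i + 2) choose (i + 2)) + int ((Suc c + i + 1) choose (i + 1))) -
      int ((a + i + 1) choose (i + 2)) * (int ((c + i + 1) choose (c + 1)) + int ((Suc c + i) choose (Suc c + 1)))"
      using Suc.IH[OF True[unfolded Suc_eq_plus1]] closed[OF True] by (simp add: algebra_simps)
    also have "int ((c + i + 2) choose (i + 2)) + int ((Suc c + i + 1) choose (i + 1)) = int ((Suc c + i + 2) choose (i + 2))"
      by simp
    also have "int ((c + i + 1) choose (c + 1)) + int ((Suc c + i) choose (Suc c + 1)) = int ((Suc c + i + 1) choose (Suc c + 1))"
      by simp
    finally show ?thesis .
  next
    case False
    then have a: "a = c + 2" using Suc.prems by simp
    have "(\<Sum>c'\<le>Suc c. int (card (bounded_pairs (Suc i) a c'))) = 0"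
      by (auto simp: a bounded_pairs_empty)
    moreover have "(Suc c + i + 1) choose (Suc c + 1) = (a + i) choose i"
      using binomial_symmetric[of i "a + i"] by (simp add: a)
    ultimately show ?thesis
      by (simp add: a)
  qed
qed

text \<open>
  The second factor of the subtracted term is morally \<open>c + i\<close> choose \<open>i - 1\<close>; the lower index \<open>c + 1\<close>
  makes it vanish for \<open>i = 0\<close> in spite of truncated subtraction.
\<close>

lemma card_bounded_pairs:
  "a \<le> c \<Longrightarrow> int (card (bounded_pairs (Suc i) a c)) =
     int ((a + i) choose i) * int ((c + i + 1) choose (i + 1)) -
     int ((a + i + 1) choose (i + 2)) * int ((c + i) choose (c + 1))"
proof (induction i arbitrary: a c)
  case 0
  have "card (bounded_pairs 0 a' c') = (if a' = 0 then 1 else 0)" for a' c'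
    by (simp add: bounded_pairs_0)
  then have "card (bounded_pairs (Suc 0) a c) = (\<Sum>a'\<le>a. if a' = 0 then c + 1 else 0)"
    unfolding card_bounded_pairs_Suc[OF 0] by (intro sum.cong) simp_all
  then show ?case by simp
next
  case (Suc i)
  have "int (card (bounded_pairs (Suc (Suc i)) a c)) =
    (\<Sum>a'\<le>a. \<Sum>c'\<le>c. int (card (bounded_pairs (Suc i) a' c')))"
    by (simp only: card_bounded_pairs_Suc[OF Suc.prems] of_nat_sum)
  also have "\<dots> = (\<Sum>a'\<le>a. int ((a' + i) choose i) * int ((c + i + 2) choose (i + 2)) -
     int ((a' + i + 1) choose (i + 2)) * int ((c + i + 1) choose (c + 1)))"
    using Suc by (intro sum.cong sum_card_bounded_pairs_snd) auto
  also have "\<dots> = int ((a + i + 1) choose (i + 1)) * int ((c + i + 2) choose (i + 2)) -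
     int ((a + i + 2) choose (i + 3)) * int ((c + i + 1) choose (c + 1))"
    by (rule sum_choose_det)
  finally show ?case
    by (simp add: numeral_3_eq_3)
qed

text \<open>Puts \<open>c = s\<close> in the closed form and sums over \<open>a\<close>. The closed
  form covers positive lengths only, so \<open>r = 0\<close> is checked directly.\<close>

lemma sum_card_bounded_pairs:
  "(\<Sum>a\<le>s. int (card (bounded_pairs r a s))) =
     int ((s + r) choose r) * int ((s + r) choose r) -
     int ((s + r + 1) choose (r + 2)) * int ((s + r - 1) choose (s + 1))"
proof (cases r)
  case 0
  have "(\<Sum>a\<le>s. int (card (bounded_pairs r a s))) = (\<Sum>a\<le>s. if a = 0 then 1 else 0)"
    by (intro sum.cong) (auto simp: 0 bounded_pairs_0)
  then show ?thesis by (simp add: 0 binomial_eq_0)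
next
  case (Suc i)
  have "(\<Sum>a\<le>s. int (card (bounded_pairs r a s))) =
     (\<Sum>a\<le>s. int ((a + i) choose i) * int ((s + i + 1) choose (i + 1)) -
     int ((a + i + 1) choose (i + 2)) * int ((s + i) choose (s + 1)))"
    unfolding Suc by (intro sum.cong card_bounded_pairs) auto
  also have "\<dots> = int ((s + i + 1) choose (i + 1)) * int ((s + i + 1) choose (i + 1)) -
     int ((s + i + 2) choose (i + 3)) * int ((s + i) choose (s + 1))"
    by (rule sum_choose_det)
  finally show ?thesis
    by (simp add: Suc numeral_3_eq_3)
qed

section \<open>From the determinant to the Narayana polynomial\<close>

text \<open>The two terms of the Narayana difference are summed separately by
  \<open>nanjundiah\<close>, after reversing the order with \<open>i = r - j\<close>: first with
  \<open>m = n = r\<close> and \<open>x = s + r\<close>, then with \<open>m = r + 2\<close>,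
  \<open>n = r - 2\<close> and \<open>x = s + r + 1\<close>.\<close>

lemma sum_narayana_choose:
  "(\<Sum>j\<le>r. narayana (Suc r) (Suc j) * of_nat ((s + 2 * r - j) choose (2 * r))) =
     of_int (\<Sum>a\<le>s. int (card (bounded_pairs r a s)))"
proof -
  have first: "(\<Sum>i\<le>r. (r choose i) * (r choose i) * ((s + r + i) choose (2 * r))) =
      ((s + r) choose r) * ((s + r) choose r)"
  proof -
    have "(\<Sum>i\<le>r. (r choose i) * (r choose i) * ((s + r + i) choose (2 * r))) =
          (\<Sum>i\<le>r. (r choose i) * (r choose (r - i)) * ((s + r + i) choose (r + r)))"
      by (intro sum.cong) (auto simp: binomial_symmetric[symmetric] mult_2)
    then show ?thesis
      by (simp add: nanjundiah)
  qed
  have second: "(\<Sum>i\<le>r. (r choose Suc i) * (r choose (Suc r - i)) * ((s + r + i) choose (2 * r))) =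
      ((s + r + 1) choose (r + 2)) * ((s + r - 1) choose (s + 1))"
  proof (cases "r \<ge> 2")
    case True
    then obtain p where r: "r = p + 2"
      using le_Suc_ex by (metis add.commute)
    \<comment> \<open>The terms at \<open>i = 0\<close> and \<open>i = r\<close> vanish; dropping
      them allows the shift \<open>i = j + 1\<close>.\<close>
    have "(\<Sum>i\<le>r. (r choose Suc i) * (r choose (Suc r - i)) * ((s + r + i) choose (2 * r))) =
          (\<Sum>i=1..p+1. (r choose Suc i) * (r choose (Suc r - i)) * ((s + r + i) choose (2 * r)))"
    proof (rule sum.mono_neutral_right)
      show "\<forall>i\<in>{..r} - {1..p+1}.
          (r choose Suc i) * (r choose (Suc r - i)) * ((s + r + i) choose (2 * r)) = 0"
      proof
        fix i assume "i \<in> {..r} - {1..p+1}"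
        then have "i = 0 \<or> i = r"
          using r by auto
        then show "(r choose Suc i) * (r choose (Suc r - i)) * ((s + r + i) choose (2 * r)) = 0"
          by auto
      qed
    qed (auto simp: r)
    also have "\<dots> = (\<Sum>j\<le>p. (r choose j) * (r choose (p - j)) * ((s + r + 1 + j) choose (r + 2 + p)))"
    proof (rule sum.reindex_bij_witness[where i = Suc and j = "\<lambda>i. i - 1"])
      fix i assume i: "i \<in> {1..p+1}"
      have "r choose Suc i = r choose (p - (i - 1))" "r choose (Suc r - i) = r choose (i - 1)"
        using binomial_symmetric[of "Suc i" r] binomial_symmetric[of "i - 1" r] i
        by (auto simp: r Suc_diff_le simp del: binomial_Suc_Suc)
      moreover have "s + r + 1 + (i - 1) = s + r + i" "r + 2 + p = 2 * r"
        using i by (simp_all add: r)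
      ultimately show "(r choose (i - 1)) * (r choose (p - (i - 1))) * ((s + r + 1 + (i - 1)) choose (r + 2 + p)) =
          (r choose Suc i) * (r choose (Suc r - i)) * ((s + r + i) choose (2 * r))"
        by (simp only: mult_ac)
    qed auto
    also have "\<dots> = ((s + r + 1) choose (r + 2)) * ((s + r + 1 - (r + 2) + r) choose p)"
      by (rule nanjundiah) (simp add: r)
    \<comment> \<open>At \<open>s = 0\<close> the subtraction of \<open>r + 2\<close> is truncated,
      but the first factor is then 0 on both sides.\<close>
    also have "\<dots> = ((s + r + 1) choose (r + 2)) * ((s + r - 1) choose (s + 1))"
    proof (cases s)
      case (Suc s')
      have "(s + r - 1) choose p = (s + r - 1) choose (s + 1)"
        by (subst binomial_symmetric) (auto simp: r)
      then show ?thesis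
        by (simp add: Suc)
    qed simp
    finally show ?thesis .
  next
    case False
    then have "r = 0 \<or> r = 1" by auto
    then show ?thesis by (auto simp: binomial_eq_0)
  qed
  have "(\<Sum>j\<le>r. narayana (Suc r) (Suc j) * of_nat ((s + 2 * r - j) choose (2 * r))) =
        (\<Sum>j\<le>r. of_nat ((r choose j) * (r choose j) * ((s + 2 * r - j) choose (2 * r))) -
               of_nat ((r choose Suc j) * (r choose (Suc r - j)) * ((s + 2 * r - j) choose (2 * r))))"
    by (intro sum.cong) (auto simp: narayana_Suc_Suc algebra_simps)
  also have "\<dots> = (\<Sum>i\<le>r. of_nat ((r choose i) * (r choose i) * ((s + r + i) choose (2 * r))) -
               of_nat ((r choose Suc i) * (r choose (Suc r - i)) * ((s + r + i) choose (2 * r))))"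
  proof (rule sum.reindex_bij_witness[where i = "\<lambda>i. r - i" and j = "\<lambda>i. r - i"])
    fix j assume j: "j \<in> {..r}"
    have "r choose (r - j) = r choose j"
      using j binomial_symmetric[of j r] by simp
    moreover have "r choose (Suc r - (r - j)) = r choose Suc j" "r choose Suc (r - j) = r choose (Suc r - j)"
      using j by (simp_all add: Suc_diff_le)
    moreover have "s + r + (r - j) = s + 2 * r - j"
      using j by simp
    ultimately show "of_nat ((r choose (r - j)) * (r choose (r - j)) * ((s + r + (r - j)) choose (2 * r))) -
               of_nat ((r choose Suc (r - j)) * (r choose (Suc r - (r - j))) * ((s + r + (r - j)) choose (2 * r))) =
        (of_nat ((r choose j) * (r choose j) * ((s + 2 * r - j) choose (2 * r))) -
               of_nat ((r choose Suc j) * (r choose (Suc r - j)) * ((s + 2 * r - j) choose (2 * r))) :: rat)"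
      by (simp only: mult_ac)
  qed auto
  also have "\<dots> = of_nat (((s + r) choose r) * ((s + r) choose r)) -
      of_nat (((s + r + 1) choose (r + 2)) * ((s + r - 1) choose (s + 1)))"
    by (simp only: sum_subtractf first second flip: of_nat_sum)
  finally show ?thesis
    by (simp only: sum_card_bounded_pairs of_int_diff of_int_mult of_int_of_nat_eq of_nat_mult)
qed

lemma coeff_narayana_poly:
  "coeff (narayana_poly (Suc r)) j = (if j \<le> r then narayana (Suc r) (Suc j) else 0)"
proof -
  have "narayana_poly (Suc r) = (\<Sum>i\<le>r. monom (narayana (Suc r) (Suc i)) i)"
    unfolding narayana_poly_def
    by (rule sum.reindex_bij_witness[where i = Suc and j = "\<lambda>i. i - 1"]) auto
  then show ?thesis
    by (simp add: coeff_sum)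
qed

lemma Abs_fps_sum_card_bounded_pairs:
  "(1 - fps_X) ^ (2 * r + 1) * Abs_fps (\<lambda>s. of_nat (\<Sum>a\<le>s. card (bounded_pairs r a s))) =
     fps_of_poly (narayana_poly (Suc r))"
proof -
  have "Abs_fps (\<lambda>s. of_nat (\<Sum>a\<le>s. card (bounded_pairs r a s))) =
     fps_of_poly (narayana_poly (Suc r)) *
     Abs_fps (\<lambda>M. of_nat ((M + (2 * r + 1) - 1) choose M))" (is "_ = ?Q * ?C")
  proof (rule fps_ext)
    fix s
    have "fps_nth (?Q * ?C) s =
       (\<Sum>j=0..s. (if j \<le> r then narayana (Suc r) (Suc j) else 0) * of_nat ((s - j + 2 * r) choose (s - j)))"
      by (simp add: fps_mult_nth coeff_narayana_poly)
    \<comment> \<open>The ranges may differ either way: for \<open>j > r\<close> the polynomial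
      coefficient is 0, for \<open>s < j \<le> r\<close> the binomial is.\<close>
    also have "\<dots> = (\<Sum>j\<le>r. narayana (Suc r) (Suc j) * of_nat ((s + 2 * r - j) choose (2 * r)))"
    proof (rule sum.mono_neutral_cong)
      fix j assume "j \<in> {0..s} \<inter> {..r}"
      then show "(if j \<le> r then narayana (Suc r) (Suc j) else 0) * of_nat ((s - j + 2 * r) choose (s - j)) =
          narayana (Suc r) (Suc j) * of_nat ((s + 2 * r - j) choose (2 * r))"
        using binomial_symmetric[of "s - j" "s - j + 2 * r"] by simp
    qed (auto simp: binomial_eq_0)
    finally show "fps_nth (Abs_fps (\<lambda>s. of_nat (\<Sum>a\<le>s. card (bounded_pairs r a s)))) s =
       fps_nth (?Q * ?C) s"
      by (simp add: sum_narayana_choose)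
  qed
  then show ?thesis
    using one_minus_X_power_mult_choose[of "2 * r + 1"]
    by (simp only: mult.left_commute mult_1_right)
qed

section \<open>Lattice points as lists of naturals\<close>

definition window_lists :: "nat \<Rightarrow> nat \<Rightarrow> nat \<Rightarrow> nat list set" where
  "window_lists k n t =
     {l. length l = n \<and> (\<forall>i. i + k \<le> n \<longrightarrow> sum_list (take k (drop i l)) \<le> t)}"

text \<open>Every position lies in a full window and entries are nonnegative. This supplies the
  coordinate bound in \<open>B_hat\<close>.\<close>

lemma nth_le_of_window_lists:
  assumes "l \<in> window_lists k n t" "1 \<le> k" "k \<le> n" "p < n"
  shows "l ! p \<le> t"
proof -
  \<comment> \<open>The window starts at \<open>p\<close>, or is the last one if that would overrun
    the list.\<close>
  define i where "i = min p (n - k)"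
  have i: "i + k \<le> n" "p - i < k" "i \<le> p"
    using assms by (auto simp: i_def)
  have len: "length l = n" and le: "sum_list (take k (drop i l)) \<le> t"
    using assms(1) i(1) by (auto simp: window_lists_def)
  have "l ! p = take k (drop i l) ! (p - i)"
    using i len by simp
  also have "\<dots> \<in> set (take k (drop i l))"
    using i len assms(4) by (intro nth_mem) auto
  finally show ?thesis
    using le member_le_sum_list order_trans by blast
qed

lemma ehrhart_B_hat_eq_card_window_lists:
  assumes "1 \<le> k" "k \<le> n"
  shows "ehrhart n (B_hat k n) t = card (window_lists k n t)"
proof -
  define f :: "nat list \<Rightarrow> nat \<Rightarrow> real" where
    "f l i = (if i \<in> {1..n} then real (l ! (i - 1)) else 0)" for l i
  have window: "(\<Sum>j=i+1..i+k. f l j) = real (sum_list (take k (drop i l)))"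
    if "length l = n" "i + k \<le> n" for l i
  proof -
    have "real (sum_list (take k (drop i l))) = (\<Sum>p=0..<k. real (l ! (i + p)))"
      using that by (simp add: sum_list_sum_nth min.absorb2)
    also have "\<dots> = (\<Sum>j=i+1..i+k. f l j)"
      by (rule sum.reindex_bij_witness[where i = "\<lambda>j. j - i - 1" and j = "\<lambda>p. i + p + 1"])
         (use that in \<open>auto simp: f_def\<close>)
    finally show ?thesis by simp
  qed
  have "inj_on f (window_lists k n t)"
  proof (rule inj_onI)
    fix l l' assume l: "l \<in> window_lists k n t" "l' \<in> window_lists k n t" "f l = f l'"
    show "l = l'"
    proof (rule nth_equalityI)
      fix p assume "p < length l"
      then show "l ! p = l' ! p"
        using fun_cong[OF l(3), of "p + 1"] l(1) by (simp add: f_def window_lists_def)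
    qed (use l in \<open>simp add: window_lists_def\<close>)
  qed
  moreover have "dilate t (B_hat k n) \<inter> Zn n = f ` window_lists k n t"
  proof
    show "f ` window_lists k n t \<subseteq> dilate t (B_hat k n) \<inter> Zn n"
    proof
      fix y assume "y \<in> f ` window_lists k n t"
      then obtain l where l: "l \<in> window_lists k n t" and y: "y = f l" by auto
      have len: "length l = n"
        using l by (simp add: window_lists_def)
      have bound: "0 \<le> f l i" "f l i \<le> real t" for i
        using nth_le_of_window_lists[OF l assms, of "i - 1"] by (auto simp: f_def)
      \<comment> \<open>For \<open>t = 0\<close> division yields the zero point, and
        \<open>bound\<close> forces \<open>f l\<close> to be zero too.\<close>
      define x where "x = (\<lambda>i. f l i / real t)"
      have fx: "f l = (\<lambda>i. real t * x i)"
        using bound by (cases "t = 0") (auto simp: x_def fun_eq_iff intro: antisym)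
      have "x \<in> B_hat k n"
      proof -
        have "(\<Sum>j=i+1..i+k. x j) \<le> 1" if "i + k \<le> n" for i
        proof -
          have "real (sum_list (take k (drop i l))) \<le> real t"
            using l that by (auto simp: window_lists_def)
          then show ?thesis
            using window[OF len that]
            by (cases "t = 0") (simp_all add: x_def sum_divide_distrib[symmetric])
        qed
        moreover have "0 \<le> x i \<and> x i \<le> 1" for i
          using bound[of i] by (cases "t = 0") (simp_all add: x_def)
        moreover have "x \<in> Rn n"
          by (auto simp: Rn_def x_def f_def)
        ultimately show ?thesis
          by (simp add: B_hat_def)
      qed
      then have "y \<in> dilate t (B_hat k n)"
        unfolding y fx dilate_def by blast
      moreover have "y \<in> Zn n"
        by (auto simp: y Zn_def Rn_def f_def)
      ultimately show "y \<in> dilate t (B_hat k n) \<inter> Zn n" by simp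
    qed
    show "dilate t (B_hat k n) \<inter> Zn n \<subseteq> f ` window_lists k n t"
    proof
      fix y assume y: "y \<in> dilate t (B_hat k n) \<inter> Zn n"
      then obtain x where x: "x \<in> B_hat k n" and yx: "y = (\<lambda>i. real t * x i)"
        by (auto simp: dilate_def)
      \<comment> \<open>Rounding loses nothing, since the coordinates of \<open>y\<close> are
        nonnegative integers.\<close>
      define l where "l = map (\<lambda>p. nat \<lfloor>y (p + 1)\<rfloor>) [0..<n]"
      have len: "length l = n" by (simp add: l_def)
      have fl: "f l = y"
      proof
        fix i
        show "f l i = y i"
        proof (cases "i \<in> {1..n}")
          case True
          then have "0 \<le> y i" "y i \<in> \<int>"
            using x y by (auto simp: B_hat_def Zn_def yx)
          then show ?thesis
            using True by (auto simp: f_def l_def elim!: Ints_cases)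
        next
          case False
          then have "y i = 0"
            using y by (auto simp: Zn_def Rn_def)
          then show ?thesis
            using False by (auto simp: f_def)
        qed
      qed
      have "sum_list (take k (drop i l)) \<le> t" if "i + k \<le> n" for i
      proof -
        have "real (sum_list (take k (drop i l))) = real t * (\<Sum>j=i+1..i+k. x j)"
          by (simp only: window[OF len that, symmetric] fl) (simp add: yx sum_distrib_left)
        also have "\<dots> \<le> real t * 1"
          using x that by (intro mult_left_mono) (auto simp: B_hat_def)
        finally show ?thesis by simp
      qed
      then have "l \<in> window_lists k n t"
        by (simp add: window_lists_def len)
      then show "y \<in> f ` window_lists k n t"
        using fl by blast
    qed
  qed
  ultimately show ?thesis
    by (simp add: ehrhart_def card_image)
qed

section \<open>Block decomposition and the Ehrhart series\<close>

text \<open>All windows contain the whole middle block, so only its sum \<open>M\<close> matters to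
  the outer blocks. Stars and bars counts the middle blocks, and the result is a convolution in
  \<open>t\<close>.\<close>

lemma card_window_lists:
  "card (window_lists (r + q) (2 * r + q) t) =
     (\<Sum>M\<le>t. ((M + q - 1) choose M) * (\<Sum>a\<le>t - M. card (bounded_pairs r a (t - M))))"
proof -
  define L where "L M = {l :: nat list. length l = q \<and> sum_list l = M}" for M
  \<comment> \<open>The labels \<open>M\<close> and \<open>a\<close> are sums of \<open>ms\<close>
    and \<open>xs\<close>, so \<open>g\<close> can forget them and remain injective.\<close>
  define T where "T = (SIGMA M:{..t}. SIGMA a:{..t - M}. L M \<times> bounded_pairs r a (t - M))"
  define g :: "nat \<times> nat \<times> nat list \<times> nat list \<times> nat list \<Rightarrow> nat list" where
    "g = (\<lambda>(M, a, ms, xs, ys). xs @ ms @ ys)"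
  have fin: "finite (L M)" for M
  proof (rule finite_subset)
    show "L M \<subseteq> {l. set l \<subseteq> {..M} \<and> length l = q}"
      by (auto simp: L_def intro: member_le_sum_list)
  qed (simp add: finite_lists_length_eq)
  have window: "(\<forall>i. i + (r + q) \<le> 2 * r + q \<longrightarrow>
                   sum_list (take (r + q) (drop i (xs @ ms @ ys))) \<le> t) \<longleftrightarrow>
                sum_list ms \<le> t \<and> window_bounded (t - sum_list ms) xs ys"
    if "length xs = r" "length ms = q" "length ys = r" for xs ms ys
  proof -
    have "sum_list (take (r + q) (drop i (xs @ ms @ ys))) =
          sum_list (drop i xs) + sum_list (take i ys) + sum_list ms" if "i \<le> r" for i
      using that \<open>length xs = r\<close> \<open>length ms = q\<close> by (simp add: add_ac)
    then have "(\<forall>i. i + (r + q) \<le> 2 * r + q \<longrightarrow>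
                   sum_list (take (r + q) (drop i (xs @ ms @ ys))) \<le> t) \<longleftrightarrow>
          (\<forall>i\<le>r. sum_list (drop i xs) + sum_list (take i ys) + sum_list ms \<le> t)"
      by auto
    also have "\<dots> \<longleftrightarrow> sum_list ms \<le> t \<and> window_bounded (t - sum_list ms) xs ys"
    proof (cases "sum_list ms \<le> t")
      case True
      then show ?thesis
        by (simp add: window_bounded_def le_diff_conv2 that)
    next
      case False
      then show ?thesis
        by (auto intro!: exI[of _ 0])
    qed
    finally show ?thesis .
  qed
  have "inj_on g T"
    by (auto simp: inj_on_def g_def T_def L_def bounded_pairs_def)
  moreover have "g ` T = window_lists (r + q) (2 * r + q) t"
  proof
    show "g ` T \<subseteq> window_lists (r + q) (2 * r + q) t"
    proof
      fix l assume "l \<in> g ` T"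
      then obtain M a ms xs ys where "(M, a, ms, xs, ys) \<in> T" and l: "l = xs @ ms @ ys"
        by (auto simp: g_def)
      then have "length xs = r" "length ms = q" "length ys = r" "sum_list ms \<le> t"
          "window_bounded (t - sum_list ms) xs ys"
        by (auto simp: T_def L_def bounded_pairs_def)
      then show "l \<in> window_lists (r + q) (2 * r + q) t"
        using window[of xs ms ys] unfolding l window_lists_def by simp
    qed
    show "window_lists (r + q) (2 * r + q) t \<subseteq> g ` T"
    proof
      fix l assume l: "l \<in> window_lists (r + q) (2 * r + q) t"
      define xs where "xs = take r l"
      define ms where "ms = take q (drop r l)"
      define ys where "ys = drop (r + q) l"
      have len: "length l = 2 * r + q"
        using l by (simp add: window_lists_def)
      have eq: "l = xs @ ms @ ys"
        by (simp add: xs_def ms_def ys_def add.commute flip: drop_drop)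
      have lens: "length xs = r" "length ms = q" "length ys = r"
        using len by (auto simp: xs_def ms_def ys_def)
      have *: "sum_list ms \<le> t" "window_bounded (t - sum_list ms) xs ys"
        using l window[OF lens] unfolding eq window_lists_def by auto
      \<comment> \<open>The window at \<open>i = 0\<close> puts the label \<open>a\<close> into its
        range in \<open>T\<close>.\<close>
      from *(2) have "sum_list xs \<le> t - sum_list ms"
        by (auto simp: window_bounded_def dest: spec[of _ 0])
      with * lens have "(sum_list ms, sum_list xs, ms, xs, ys) \<in> T"
        by (auto simp: T_def L_def bounded_pairs_def)
      then show "l \<in> g ` T"
        unfolding eq by (force simp: g_def)
    qed
  qed
  ultimately have "card (window_lists (r + q) (2 * r + q) t) = card T"
    using card_image by metis
  also have "\<dots> = (\<Sum>M\<le>t. \<Sum>a\<le>t - M. card (L M) * card (bounded_pairs r a (t - M)))"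
    unfolding T_def by (simp add: fin finite_bounded_pairs card_cartesian_product)
  also have "\<dots> = (\<Sum>M\<le>t. ((M + q - 1) choose M) * (\<Sum>a\<le>t - M. card (bounded_pairs r a (t - M))))"
    by (simp add: L_def card_length_sum_list sum_distrib_left)
  finally show ?thesis .
qed

theorem theorem2p12:
  fixes k n :: nat
  assumes "1 \<le> k" and "k \<le> n" and "n \<le> 2 * k"
  shows "ehrhart_hstar n (B_hat k n) = fps_of_poly (narayana_poly (n - k + 1))"
proof -
  define r where "r = n - k"
  define q where "q = k - r"
  \<comment> \<open>The hypothesis \<open>n \<le> 2 * k\<close> means \<open>r \<le> k\<close>, so
    \<open>k - r\<close> is not truncated.\<close>
  have k: "k = r + q" and n: "n = 2 * r + q"
    using assms by (auto simp: r_def q_def)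
  define C :: "rat fps" where "C = Abs_fps (\<lambda>M. of_nat ((M + q - 1) choose M))"
  define F :: "rat fps" where "F = Abs_fps (\<lambda>s. of_nat (\<Sum>a\<le>s. card (bounded_pairs r a s)))"
  have "Abs_fps (\<lambda>t. of_nat (ehrhart n (B_hat k n) t)) = C * F"
  proof (rule fps_ext)
    fix t
    have "ehrhart n (B_hat k n) t =
        (\<Sum>M\<le>t. ((M + q - 1) choose M) * (\<Sum>a\<le>t - M. card (bounded_pairs r a (t - M))))"
      using card_window_lists[of r q t]
      by (simp only: ehrhart_B_hat_eq_card_window_lists[OF assms(1,2)] flip: k n)
    then show "fps_nth (Abs_fps (\<lambda>t. of_nat (ehrhart n (B_hat k n) t))) t = fps_nth (C * F) t"
      by (simp add: C_def F_def fps_mult_nth atLeast0AtMost)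
  qed
  \<comment> \<open>The exponent splits: \<open>q\<close> factors cancel the middle block, and
    \<open>2 * r + 1\<close> turn the pair series into the polynomial.\<close>
  moreover have "n + 1 = q + (2 * r + 1)"
    by (simp add: n)
  ultimately have "ehrhart_hstar n (B_hat k n) = ((1 - fps_X) ^ q * C) * ((1 - fps_X) ^ (2 * r + 1) * F)"
    unfolding ehrhart_hstar_def by (simp only: power_add mult_ac)
  also have "\<dots> = fps_of_poly (narayana_poly (Suc r))"
    unfolding C_def F_def one_minus_X_power_mult_choose Abs_fps_sum_card_bounded_pairs by simp
  finally show ?thesis
    by (simp add: r_def)
qed

end
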